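(* Let $\mathbb{F}$ be a finite field of order $q$, $\theta$ a non-trivial additive character of $\mathbb{F}$, and $n\ge0$ an integer. Let $\varPhi_n$ be the canonical matrix of the pair $(\mathbb{F}^n,(\mathbb{F}^\times)^n\rtimes\mathfrak{S}_n)$. Let $k\ge1$ and let $0\le r_1,\dots,r_k,r\le n$ be integers such that $r_1+\cdots+r_k\le r$. Then $$\sum_{s=0}^n(q-1)^s\binom ns\varPhi_n(s,r_1)\cdots\varPhi_n(s,r_k)\,\varPhi_n(s,r)=\delta_{r_1+\cdots+r_k,\,r}\;\frac{n!}{(n-r)!\,r_1!\cdots r_k!}\,(q-1)^rq^n,$$ where $\delta$ is Kronecker's delta.
   Context: For $a\in\mathbb{F}^n$ let $\operatorname{wt}a$ be the number of non-zero coordinates of $a$ and let $\langle a|b\rangle=\sum_ja_jb_j$. The canonical matrix is $$\varPhi_n(s,r)=\sum_{b\in\mathbb{F}^n,\ \operatorname{wt}b=r}\overline{\theta(\langle a|b\rangle)},\qquad a\in\mathbb{F}^n\text{ any element with }\operatorname{wt}a=s$$ (independent of the choice of $a$). *)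

theory Defs
  imports Complex_Main "HOL-Library.Cardinality" "Jordan_Normal_Form.Matrix"
begin

text \<open>A complex character of the additive group of a field, i.e. a homomorphism into the
  multiplicative group of non-zero complex numbers.\<close>

definition additive_character :: "('a::field \<Rightarrow> complex) \<Rightarrow> bool" where
  "additive_character \<theta> \<longleftrightarrow> (\<forall>x y. \<theta> (x + y) = \<theta> x * \<theta> y) \<and> (\<forall>x. \<theta> x \<noteq> 0)"

definition nontrivial_additive_character :: "('a::field \<Rightarrow> complex) \<Rightarrow> bool" where
  "nontrivial_additive_character \<theta> \<longleftrightarrow> additive_character \<theta> \<and> (\<exists>x. \<theta> x \<noteq> 1)"

definition wt :: "'a::zero vec \<Rightarrow> nat" where
  "wt a = card {i. i < dim_vec a \<and> a $ i \<noteq> 0}"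

definition weight_sphere_sum :: "('a::field \<Rightarrow> complex) \<Rightarrow> nat \<Rightarrow> 'a vec \<Rightarrow> nat \<Rightarrow> complex" where
  "weight_sphere_sum \<theta> n a r = (\<Sum>b\<in>{b \<in> carrier_vec n. wt b = r}. cnj (\<theta> (a \<bullet> b)))"

text \<open>The choice of the representative of weight \<open>s\<close> (which exists for \<open>s \<le> n\<close>) is immaterial, see
  \<open>canonical_matrix_eq\<close> below.\<close>

definition canonical_matrix :: "('a::field \<Rightarrow> complex) \<Rightarrow> nat \<Rightarrow> nat \<Rightarrow> nat \<Rightarrow> complex" where
  "canonical_matrix \<theta> n s r = weight_sphere_sum \<theta> n (SOME a. a \<in> carrier_vec n \<and> wt a = s) r"

lemma ex_vec_wt:
  assumes "s \<le> n"
  shows "\<exists>a \<in> carrier_vec n. wt (a :: 'a::field vec) = s"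
proof (rule bexI)
  have "{i. i < n \<and> vec n (\<lambda>i. if i < s then 1 else (0::'a)) $ i \<noteq> 0} = {..<s}"
    using assms by (auto split: if_splits)
  then show "wt (vec n (\<lambda>i. if i < s then 1 else (0::'a))) = s"
    by (simp add: wt_def)
qed simp

lemma weight_sphere_sum_cong:
  fixes a a' :: "'a::field vec"
  assumes a: "a \<in> carrier_vec n" and a': "a' \<in> carrier_vec n" and w: "wt a = wt a'"
  shows "weight_sphere_sum \<theta> n a r = weight_sphere_sum \<theta> n a' r"
proof -
  define S where "S = {i. i < n \<and> a $ i \<noteq> 0}"
  define S' where "S' = {i. i < n \<and> a' $ i \<noteq> 0}"
  have fin: "finite S" "finite S'" and sub: "S \<subseteq> {..<n}" "S' \<subseteq> {..<n}"
    by (auto simp: S_def S'_def)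
  have cS: "card S = card S'"
    using w a a' by (simp add: wt_def S_def S'_def)
  then obtain f where f: "bij_betw f S S'"
    using fin by (metis finite_same_card_bij)
  have "card ({..<n} - S) = card ({..<n} - S')"
    using cS fin sub by (simp add: card_Diff_subset)
  then obtain g where g: "bij_betw g ({..<n} - S) ({..<n} - S')"
    using finite_same_card_bij by blast
  define p where "p i = (if i \<in> S then f i else g i)" for i
  have p1: "bij_betw p S S'"
    using f by (subst bij_betw_cong[where g = f]) (auto simp: p_def)
  have p2: "bij_betw p ({..<n} - S) ({..<n} - S')"
    using g by (subst bij_betw_cong[where g = g]) (auto simp: p_def)
  have p: "bij_betw p {..<n} {..<n}"
    using bij_betw_combine[OF p1 p2] sub by (simp add: Un_absorb1)
  define p' where "p' = inv_into {..<n} p"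
  have p': "bij_betw p' {..<n} {..<n}"
    unfolding p'_def using p by (rule bij_betw_inv_into)
  have pp' [simp]: "p (p' i) = i" "p' (p i) = i" if "i < n" for i
    using p that by (auto simp: p'_def bij_betw_inv_into_right bij_betw_inv_into_left)
  have pn [simp]: "p i < n" "p' i < n" if "i < n" for i
    using bij_betwE[OF p] bij_betwE[OF p'] that by auto
  have supp: "a' $ p i \<noteq> 0 \<longleftrightarrow> a $ i \<noteq> 0" if i: "i < n" for i
  proof -
    have "p i \<in> S' \<longleftrightarrow> i \<in> S"
      using bij_betwE[OF p1] bij_betwE[OF p2] i by auto
    then show ?thesis using i by (simp add: S_def S'_def)
  qed
  define c where "c i = (if a $ i = 0 then 1 else a $ i / a' $ p i)" for i
  have c0 [simp]: "c i \<noteq> 0" if "i < n" for i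
    using supp[OF that] by (auto simp: c_def)
  have ac: "a' $ p i * c i = a $ i" if "i < n" for i
    using supp[OF that] by (auto simp: c_def)
  define F where "F b = vec n (\<lambda>j. c (p' j) * b $ p' j)" for b :: "'a vec"
  define G where "G b = vec n (\<lambda>i. b $ p i / c i)" for b :: "'a vec"
  have wtF: "wt (F b) = wt b" if "b \<in> carrier_vec n" for b
  proof -
    have "bij_betw p {i. i < n \<and> b $ i \<noteq> 0} {j. j < n \<and> F b $ j \<noteq> 0}"
      by (rule bij_betw_byWitness[where f' = p']) (auto simp: F_def)
    then show ?thesis
      using that by (simp add: wt_def bij_betw_same_card F_def)
  qed
  have GF: "G (F b) = b" if "b \<in> carrier_vec n" for b
    using that by (intro eq_vecI) (auto simp: F_def G_def)
  have FG: "F (G b) = b" if "b \<in> carrier_vec n" for b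
    using that by (intro eq_vecI) (auto simp: F_def G_def)
  have FGc [simp]: "F b \<in> carrier_vec n" "G b \<in> carrier_vec n" for b
    by (auto simp: F_def G_def)
  have wtG: "wt (G b) = wt b" if "b \<in> carrier_vec n" for b
    using wtF[of "G b"] FG[OF that] by simp
  have sp: "a' \<bullet> F b = a \<bullet> b" if b: "b \<in> carrier_vec n" for b
  proof -
    have "a' \<bullet> F b = (\<Sum>j\<in>{..<n}. a' $ j * (c (p' j) * b $ p' j))"
      by (simp add: scalar_prod_def F_def atLeast0LessThan)
    also have "\<dots> = (\<Sum>i\<in>{..<n}. a' $ p i * (c (p' (p i)) * b $ p' (p i)))"
      by (rule sum.reindex_bij_betw[OF p, symmetric])
    also have "\<dots> = (\<Sum>i\<in>{..<n}. a $ i * b $ i)"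
      by (rule sum.cong) (auto simp: ac mult.assoc[symmetric])
    also have "\<dots> = a \<bullet> b"
      using b by (simp add: scalar_prod_def atLeast0LessThan)
    finally show ?thesis .
  qed
  show ?thesis
    unfolding weight_sphere_sum_def
    by (rule sum.reindex_bij_witness[where i = G and j = F])
      (auto simp: GF FG wtF wtG sp)
qed

lemma canonical_matrix_eq:
  fixes a :: "'a::field vec"
  assumes "a \<in> carrier_vec n" "wt a = s"
  shows "canonical_matrix \<theta> n s r = (\<Sum>b\<in>{b \<in> carrier_vec n. wt b = r}. cnj (\<theta> (a \<bullet> b)))"
proof -
  define a' :: "'a vec" where "a' = (SOME a. a \<in> carrier_vec n \<and> wt a = s)"
  have "a' \<in> carrier_vec n \<and> wt a' = s"
    unfolding a'_def by (rule someI[where x = a]) (use assms in simp)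
  then have "weight_sphere_sum \<theta> n a' r = weight_sphere_sum \<theta> n a r"
    using assms by (intro weight_sphere_sum_cong) auto
  then show ?thesis
    by (simp add: canonical_matrix_def weight_sphere_sum_def a'_def)
qed

end

theory Submission
  imports Defs
begin

text \<open>
  Grouping \<open>F\<^sup>n\<close> by weight turns the left-hand side into
  the sum over all \<open>a \<in> F\<^sup>n\<close> of a product of sphere sums. Expanding only the last
  factor, it remains to evaluate the Fourier transform of the product of the other factors at vectors
  \<open>w\<close> of weight \<open>r\<close>. This is done by induction on the number of factors for all \<open>w\<close> with
  \<open>wt w \<ge> r\<^sub>1 + \<dots> + r\<^sub>k\<close>: removing the factor of radius \<open>m\<close> replaces \<open>w\<close> by the vectors
  \<open>w + b\<close> with \<open>wt b = m\<close>, whose weight is at least \<open>wt w - m\<close>, with equality exactly when \<open>- b\<close> is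
  the restriction of \<open>w\<close> to an \<open>m\<close>-element subset of its support.
\<close>

section \<open>Supports and weights of vectors\<close>

definition vec_support :: "'a::zero vec \<Rightarrow> nat set" where
  "vec_support a = {i. i < dim_vec a \<and> a $ i \<noteq> 0}"

lemma wt_eq_card_support: "wt a = card (vec_support a)"
  by (simp add: wt_def vec_support_def)

lemma finite_vec_support [simp]: "finite (vec_support a)"
  by (simp add: vec_support_def)

lemma vec_support_subset: "a \<in> carrier_vec n \<Longrightarrow> vec_support a \<subseteq> {..<n}"
  by (auto simp: vec_support_def)

lemma wt_le: "a \<in> carrier_vec n \<Longrightarrow> wt a \<le> n"
  using card_mono[OF _ vec_support_subset, of n a] by (simp add: wt_eq_card_support)

lemma wt_eq_0_iff: "wt a = 0 \<longleftrightarrow> a = 0\<^sub>v (dim_vec a)"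
  by (auto simp: wt_eq_card_support vec_support_def vec_eq_iff)

section \<open>Counting vectors, also by support and by weight\<close>

lemma bij_betw_vec_PiE:
  "bij_betw (vec n) ({..<n} \<rightarrow>\<^sub>E (UNIV :: 'a set)) (carrier_vec n)"
\<comment> \<open>\<open>restrict\<close> is needed in the inverse because members of
  \<open>PiE\<close> are \<open>undefined\<close> outside the index set.\<close>
proof (rule bij_betw_byWitness[where f' = "\<lambda>a. restrict (($) a) {..<n}"])
  show "\<forall>f\<in>{..<n} \<rightarrow>\<^sub>E (UNIV :: 'a set). restrict (($) (vec n f)) {..<n} = f"
  proof
    fix f assume "f \<in> {..<n} \<rightarrow>\<^sub>E (UNIV :: 'a set)"
    then have "f \<in> extensional {..<n}" by (simp add: PiE_iff)
    then show "restrict (($) (vec n f)) {..<n} = f"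
      by (intro extensionalityI[where A = "{..<n}"]) simp_all
  qed
  show "\<forall>a\<in>carrier_vec n. vec n (restrict (($) a) {..<n}) = (a :: 'a vec)"
    by (intro ballI eq_vecI) simp_all
  show "vec n ` ({..<n} \<rightarrow>\<^sub>E (UNIV :: 'a set)) \<subseteq> carrier_vec n"
    by (rule image_subsetI) (rule vec_carrier)
  show "(\<lambda>a. restrict (($) a) {..<n}) ` carrier_vec n \<subseteq> {..<n} \<rightarrow>\<^sub>E (UNIV :: 'a set)"
    by (rule image_subsetI) (simp add: restrict_PiE_iff)
qed

lemma finite_carrier_vec [simp]: "finite (carrier_vec n :: 'a::finite vec set)"
proof -
  have "finite ({..<n} \<rightarrow>\<^sub>E (UNIV :: 'a set))"
    by (rule finite_PiE) (rule finite_lessThan, rule finite)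
  then show ?thesis
    by (simp only: bij_betw_finite[OF bij_betw_vec_PiE])
qed

lemma card_carrier_vec: "card (carrier_vec n :: 'a::finite vec set) = CARD('a) ^ n"
proof -
  have "card ({..<n} \<rightarrow>\<^sub>E (UNIV :: 'a set)) = CARD('a) ^ n"
    by (subst card_PiE) (rule finite_lessThan, simp only: prod_constant card_lessThan)
  then show ?thesis
    by (simp only: bij_betw_same_card[OF bij_betw_vec_PiE])
qed

lemma card_vec_support_eq:
  assumes "S \<subseteq> {..<n}"
  shows "card {a \<in> carrier_vec n. vec_support (a :: 'a::{zero,finite} vec) = S} = (CARD('a) - 1) ^ card S"
proof -
  let ?g = "\<lambda>f :: nat \<Rightarrow> 'a. vec n (\<lambda>i. if i \<in> S then f i else 0)"
  have "bij_betw ?g (S \<rightarrow>\<^sub>E (UNIV - {0 :: 'a})) {a \<in> carrier_vec n. vec_support a = S}"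
  proof (rule bij_betw_byWitness[where f' = "\<lambda>a. restrict (($) a) S"])
    show "\<forall>f\<in>S \<rightarrow>\<^sub>E (UNIV - {0}). restrict (($) (?g f)) S = f"
    proof
      fix f :: "nat \<Rightarrow> 'a" assume "f \<in> S \<rightarrow>\<^sub>E (UNIV - {0})"
      then have "f \<in> extensional S" by (simp add: PiE_iff)
      moreover have "?g f $ i = f i" if "i \<in> S" for i
        using that assms by auto
      ultimately show "restrict (($) (?g f)) S = f"
        by (intro extensionalityI[where A = S]) simp_all
    qed
    show "\<forall>a\<in>{a \<in> carrier_vec n. vec_support a = S}. ?g (restrict (($) a) S) = a"
      by (auto simp: vec_support_def)
    show "?g ` (S \<rightarrow>\<^sub>E (UNIV - {0})) \<subseteq> {a \<in> carrier_vec n. vec_support a = S}"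
    proof (rule image_subsetI)
      fix f :: "nat \<Rightarrow> 'a" assume "f \<in> S \<rightarrow>\<^sub>E (UNIV - {0})"
      then have "f i \<noteq> 0" if "i \<in> S" for i
        using that by (auto simp: PiE_iff)
      then have "vec_support (?g f) = S"
        using assms by (auto simp: vec_support_def split: if_splits)
      then show "?g f \<in> {a \<in> carrier_vec n. vec_support a = S}"
        by simp
    qed
    show "(\<lambda>a. restrict (($) a) S) ` {a \<in> carrier_vec n. vec_support a = S} \<subseteq> S \<rightarrow>\<^sub>E (UNIV - {0})"
      by (auto simp: vec_support_def)
  qed
  moreover have "card (S \<rightarrow>\<^sub>E (UNIV - {0 :: 'a})) = (CARD('a) - 1) ^ card S"
    using finite_subset[OF assms finite_lessThan]
    by (subst card_PiE) (assumption, simp only: prod_constant card_Diff_singleton[OF UNIV_I])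
  ultimately show ?thesis
    by (simp only: bij_betw_same_card)
qed

text \<open>The sphere is the disjoint union, over the s-subsets S of the n positions, of the
  vectors with support S, and each such S leaves a free choice of s non-zero entries.\<close>

lemma card_weight_sphere:
  "card {a \<in> carrier_vec n. wt (a :: 'a::{zero,finite} vec) = s} = (n choose s) * (CARD('a) - 1) ^ s"
proof -
  let ?T = "{S. S \<subseteq> {..<n} \<and> card S = s}"
  have "{a \<in> carrier_vec n. wt (a :: 'a vec) = s}
      = (\<Union>S\<in>?T. {a \<in> carrier_vec n. vec_support a = S})"
    using vec_support_subset by (auto simp: wt_eq_card_support)
  also have "card \<dots> = (\<Sum>S\<in>?T. card {a \<in> carrier_vec n. vec_support (a :: 'a vec) = S})"
    by (rule card_UN_disjoint) auto
  also have "\<dots> = (\<Sum>S\<in>?T. (CARD('a) - 1) ^ s)"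
    by (rule sum.cong) (auto simp: card_vec_support_eq)
  also have "\<dots> = (n choose s) * (CARD('a) - 1) ^ s"
    by (simp add: n_subsets)
  finally show ?thesis .
qed

section \<open>Weight loss under addition of a vector\<close>

lemma vec_support_diff_subset:
  fixes w b :: "'a::group_add vec"
  assumes "w \<in> carrier_vec n" "b \<in> carrier_vec n"
  shows "vec_support w - vec_support b \<subseteq> vec_support (w + b)"
  using assms by (auto simp: vec_support_def)

lemma wt_add_ge:
  fixes w b :: "'a::group_add vec"
  assumes "w \<in> carrier_vec n" "b \<in> carrier_vec n"
  shows "wt w \<le> wt (w + b) + wt b"
proof -
  have "card (vec_support w) \<le> card (vec_support w - vec_support b) + card (vec_support b)"
    using diff_card_le_card_Diff[of "vec_support b" "vec_support w"] by simp
  then show ?thesis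
    using card_mono[OF _ vec_support_diff_subset[OF assms]] by (simp add: wt_eq_card_support)
qed

text \<open>Equality in \<open>wt_add_ge\<close> means that b spends its whole support on cancelling
  entries of w: it has no non-zero entry outside the support of w, and each one inside cancels
  completely.\<close>

lemma wt_add_eq_imp:
  fixes w b :: "'a::group_add vec"
  assumes w: "w \<in> carrier_vec n" and b: "b \<in> carrier_vec n" and eq: "wt w = wt (w + b) + wt b"
  shows "vec_support b \<subseteq> vec_support w"
    and "b = vec n (\<lambda>i. if i \<in> vec_support b then - (w $ i) else 0)"
proof -
  let ?w = "vec_support w" and ?b = "vec_support b" and ?s = "vec_support (w + b)"
  have le: "card (?w - ?b) \<le> card ?s"
    by (rule card_mono[OF _ vec_support_diff_subset[OF w b]]) simp
  have split: "card ?w = card (?w - ?b) + card (?w \<inter> ?b)"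
    by (subst card_Un_disjoint[symmetric]) (auto intro: arg_cong[where f = card])
  have le': "card (?w \<inter> ?b) \<le> card ?b"
    by (rule card_mono) auto
  \<comment> \<open>By \<open>split\<close> and \<open>eq\<close>, the two sides of
    \<open>le\<close> and \<open>le'\<close> have the same total, so both inequalities are
    tight.\<close>
  have "card (?w \<inter> ?b) = card ?b" and eqs: "card (?w - ?b) = card ?s"
    using eq le le' split unfolding wt_eq_card_support by linarith+
  then have "?w \<inter> ?b = ?b"
    by (intro card_subset_eq) auto
  then show "?b \<subseteq> ?w" by blast
  have s: "?w - ?b = ?s"
    using eqs vec_support_diff_subset[OF w b] by (intro card_subset_eq) auto
  show "b = vec n (\<lambda>i. if i \<in> ?b then - (w $ i) else 0)"
  proof (rule eq_vecI)
    fix i assume "i < dim_vec (vec n (\<lambda>i. if i \<in> ?b then - (w $ i) else 0))"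
    then have i: "i < n" by simp
    have "b $ i = - (w $ i)" if "i \<in> ?b"
    proof -
      have "i \<notin> ?s" using s that by blast
      then have "w $ i + b $ i = 0"
        using i w b by (simp add: vec_support_def)
      then show ?thesis
        by (rule minus_unique[symmetric])
    qed
    moreover have "b $ i = 0" if "i \<notin> ?b"
      using that i b by (simp add: vec_support_def)
    ultimately show "b $ i = vec n (\<lambda>i. if i \<in> ?b then - (w $ i) else 0) $ i"
      using i by simp
  qed (use b in simp)
qed

text \<open>By the equality case \<open>wt_add_eq_imp\<close>, such a b is determined by its
  support, and every m-subset of the support of w occurs as one.\<close>

lemma card_weight_drop:
  fixes w :: "'a::group_add vec"
  assumes w: "w \<in> carrier_vec n" and m: "m \<le> wt w"
  shows "card {b \<in> carrier_vec n. wt b = m \<and> wt (w + b) = wt w - m} = (wt w choose m)"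
proof -
  let ?g = "\<lambda>T. vec n (\<lambda>i. if i \<in> T then - (w $ i) else 0)"
  let ?T = "{T. T \<subseteq> vec_support w \<and> card T = m}"
  have supp: "vec_support (?g T) = T" if "T \<subseteq> vec_support w" for T
    using that w by (auto simp: vec_support_def split: if_splits)
  have supp': "vec_support (w + ?g T) = vec_support w - T" if "T \<subseteq> vec_support w" for T
    using that w by (auto simp: vec_support_def split: if_splits)
  have fin: "finite T" if "T \<subseteq> vec_support w" for T
    by (rule finite_subset[OF that finite_vec_support])
  have "bij_betw ?g ?T {b \<in> carrier_vec n. wt b = m \<and> wt (w + b) = wt w - m}"
  proof (rule bij_betw_byWitness[where f' = vec_support])
    show "?g ` ?T \<subseteq> {b \<in> carrier_vec n. wt b = m \<and> wt (w + b) = wt w - m}"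
      by (auto simp: wt_eq_card_support supp supp' fin card_Diff_subset)
    show "\<forall>T\<in>?T. vec_support (?g T) = T"
      by (simp add: supp)
    show "\<forall>b\<in>{b \<in> carrier_vec n. wt b = m \<and> wt (w + b) = wt w - m}. ?g (vec_support b) = b"
    proof
      fix b assume "b \<in> {b \<in> carrier_vec n. wt b = m \<and> wt (w + b) = wt w - m}"
      then have "b \<in> carrier_vec n" "wt w = wt (w + b) + wt b"
        using m by simp_all
      then show "?g (vec_support b) = b"
        by (rule wt_add_eq_imp(2)[OF w, symmetric])
    qed
    show "vec_support ` {b \<in> carrier_vec n. wt b = m \<and> wt (w + b) = wt w - m} \<subseteq> ?T"
    proof (rule image_subsetI)
      fix b assume b: "b \<in> {b \<in> carrier_vec n. wt b = m \<and> wt (w + b) = wt w - m}"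
      then have "b \<in> carrier_vec n" "wt w = wt (w + b) + wt b"
        using m by simp_all
      then have "vec_support b \<subseteq> vec_support w"
        by (rule wt_add_eq_imp(1)[OF w])
      then show "vec_support b \<in> ?T"
        using b by (simp add: wt_eq_card_support)
    qed
  qed
  then have "card ?T = card {b \<in> carrier_vec n. wt b = m \<and> wt (w + b) = wt w - m}"
    by (rule bij_betw_same_card)
  then show ?thesis
    by (simp only: n_subsets[OF finite_vec_support] wt_eq_card_support[of w])
qed

section \<open>Character sums\<close>

lemma nontrivial_additive_character_cnj:
  "nontrivial_additive_character \<theta> \<Longrightarrow> nontrivial_additive_character (\<lambda>x. cnj (\<theta> x))"
  by (auto simp: nontrivial_additive_character_def additive_character_def)

lemma additive_character_zero:
  assumes "additive_character \<chi>"
  shows "\<chi> 0 = 1"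
proof -
  \<comment> \<open>The first equation comes from 0 + 0 = 0.\<close>
  have "\<chi> 0 * \<chi> 0 = \<chi> 0 * 1" "\<chi> 0 \<noteq> 0"
    using assms unfolding additive_character_def by (metis add_0 mult_1_right, metis)
  then show ?thesis by (metis mult_left_cancel)
qed

lemma sum_additive_character_scalar_prod:
  fixes \<chi> :: "'a::{field,finite} \<Rightarrow> complex"
  assumes \<chi>: "nontrivial_additive_character \<chi>" and w: "w \<in> carrier_vec n"
  shows "(\<Sum>a\<in>carrier_vec n. \<chi> (a \<bullet> w)) = (if w = 0\<^sub>v n then of_nat CARD('a) ^ n else 0)"
proof (cases "w = 0\<^sub>v n")
  case True
  have "\<chi> 0 = 1"
    using \<chi> additive_character_zero by (auto simp: nontrivial_additive_character_def)
  then show ?thesis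
    using True by (simp add: card_carrier_vec)
next
  case False
  have hom: "\<chi> (x + y) = \<chi> x * \<chi> y" for x y
    using \<chi> by (auto simp: nontrivial_additive_character_def additive_character_def)
  obtain x where x: "\<chi> x \<noteq> 1"
    using \<chi> by (auto simp: nontrivial_additive_character_def)
  obtain i where i: "i < n" "w $ i \<noteq> 0"
    using False w by (auto simp: vec_eq_iff)
  \<comment> \<open>The scaling gives \<open>c \<bullet> w = x\<close>. Translating the summation
    variable by c then multiplies the sum by \<open>\<chi> x\<close>, which differs from 1, so the
    sum vanishes.\<close>
  define c where "c = (x / w $ i) \<cdot>\<^sub>v unit_vec n i"
  have c: "c \<in> carrier_vec n" "c \<bullet> w = x"
    using i w by (simp_all add: c_def)
  let ?S = "\<Sum>a\<in>carrier_vec n. \<chi> (a \<bullet> w)"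
  have "a - c + c = a" "a + c - c = a" if "a \<in> carrier_vec n" for a
    using that c(1) by auto
  then have "bij_betw (\<lambda>a. a + c) (carrier_vec n) (carrier_vec n)"
    using c(1) by (intro bij_betw_byWitness[where f' = "\<lambda>a. a - c"]) auto
  then have "?S = (\<Sum>a\<in>carrier_vec n. \<chi> ((a + c) \<bullet> w))"
    by (rule sum.reindex_bij_betw[symmetric])
  also have "\<dots> = (\<Sum>a\<in>carrier_vec n. \<chi> (a \<bullet> w) * \<chi> x)"
    by (rule sum.cong) (use c w in \<open>auto simp: add_scalar_prod_distrib[where n = n] hom\<close>)
  also have "\<dots> = ?S * \<chi> x"
    by (simp add: sum_distrib_right)
  finally show ?thesis
    using x False by simp
qed

text \<open>The lower bound on the weight of w passes to every w + b in the induction, so the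
  induction hypothesis applies to all of them. Only those of the least possible weight contribute,
  and their number supplies the next factor of the multinomial coefficient.\<close>

lemma fourier_prod_weight_sphere_sum:
  fixes \<theta> :: "'a::{field,finite} \<Rightarrow> complex" and k :: nat
  assumes \<theta>: "nontrivial_additive_character \<theta>"
    and "w \<in> carrier_vec n" and "(\<Sum>i=1..k. \<rho> i) \<le> wt w"
  shows "(\<Sum>a\<in>carrier_vec n. (\<Prod>i=1..k. weight_sphere_sum \<theta> n a (\<rho> i)) * cnj (\<theta> (a \<bullet> w)))
    = (if (\<Sum>i=1..k. \<rho> i) = wt w
       then fact (wt w) / (\<Prod>i=1..k. fact (\<rho> i)) * of_nat CARD('a) ^ n else 0)"
  using assms(2,3)
proof (induction k arbitrary: w)
  case 0
  \<comment> \<open>The empty product is 1, so the base case is orthogonality of characters; weight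
    0 singles out the zero vector.\<close>
  then have "w = 0\<^sub>v n \<longleftrightarrow> 0 = wt w"
    using wt_eq_0_iff[of w] by (metis carrier_vecD)
  then show ?case
    using sum_additive_character_scalar_prod[OF nontrivial_additive_character_cnj[OF \<theta>] 0(1)]
    by (cases "wt w = 0") simp_all
next
  case (Suc k)
  note w = Suc.prems(1)
  let ?m = "\<rho> (Suc k)" and ?R = "\<Sum>i=1..k. \<rho> i"
  let ?P = "\<lambda>a. \<Prod>i=1..k. weight_sphere_sum \<theta> n a (\<rho> i)"
  let ?C = "fact ?R / (\<Prod>i=1..k. fact (\<rho> i)) * of_nat CARD('a) ^ n :: complex"
  let ?B = "{b \<in> carrier_vec n. wt b = ?m} :: 'a vec set"
  have le: "?R + ?m \<le> wt w"
    using Suc.prems(2) by simp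
  have hom: "\<theta> (x + y) = \<theta> x * \<theta> y" for x y
    using \<theta> by (auto simp: nontrivial_additive_character_def additive_character_def)
  \<comment> \<open>Expanding the last factor over b and merging the two characters shifts the
    frequency from w to w + b.\<close>
  have "(\<Sum>a\<in>carrier_vec n. (\<Prod>i=1..Suc k. weight_sphere_sum \<theta> n a (\<rho> i)) * cnj (\<theta> (a \<bullet> w)))
      = (\<Sum>a\<in>carrier_vec n. \<Sum>b\<in>?B. ?P a * cnj (\<theta> (a \<bullet> (w + b))))"
  proof (rule sum.cong)
    fix a :: "'a vec" assume a: "a \<in> carrier_vec n"
    have "(\<Prod>i=1..Suc k. weight_sphere_sum \<theta> n a (\<rho> i)) * cnj (\<theta> (a \<bullet> w))
        = (\<Sum>b\<in>?B. ?P a * (cnj (\<theta> (a \<bullet> w)) * cnj (\<theta> (a \<bullet> b))))"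
      by (simp add: weight_sphere_sum_def sum_distrib_left sum_distrib_right mult_ac)
    also have "\<dots> = (\<Sum>b\<in>?B. ?P a * cnj (\<theta> (a \<bullet> (w + b))))"
      by (rule sum.cong) (use a w in \<open>auto simp: scalar_prod_add_distrib[where n = n] hom\<close>)
    finally show "(\<Prod>i=1..Suc k. weight_sphere_sum \<theta> n a (\<rho> i)) * cnj (\<theta> (a \<bullet> w)) = \<dots>" .
  qed simp
  also have "\<dots> = (\<Sum>b\<in>?B. \<Sum>a\<in>carrier_vec n. ?P a * cnj (\<theta> (a \<bullet> (w + b))))"
    by (rule sum.swap)
  also have "\<dots> = (\<Sum>b\<in>?B. if wt (w + b) = ?R then ?C else 0)"
  proof (rule sum.cong)
    fix b assume b: "b \<in> ?B"
    then have "wt w \<le> wt (w + b) + ?m"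
      using wt_add_ge[OF w, of b] by simp
    then have "?R \<le> wt (w + b)"
      using le by linarith
    then show "(\<Sum>a\<in>carrier_vec n. ?P a * cnj (\<theta> (a \<bullet> (w + b)))) = (if wt (w + b) = ?R then ?C else 0)"
      using Suc.IH[of "w + b"] b w by (cases "wt (w + b) = ?R") simp_all
  qed simp
  also have "\<dots> = of_nat (card {b \<in> carrier_vec n. wt b = ?m \<and> wt (w + b) = ?R}) * ?C"
  proof -
    have "?B \<inter> {b. wt (w + b) = ?R} = {b \<in> carrier_vec n. wt b = ?m \<and> wt (w + b) = ?R}"
      by auto
    then show ?thesis
      by (simp add: sum.If_cases)
  qed
  also have "\<dots> = (if ?R + ?m = wt w
       then fact (wt w) / (\<Prod>i=1..Suc k. fact (\<rho> i)) * of_nat CARD('a) ^ n else 0)"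
  proof (cases "?R + ?m = wt w")
    case True
    then have R: "wt w - ?m = ?R" and m: "?m \<le> wt w" by linarith+
    \<comment> \<open>Multiplied by \<open>?C\<close>, this cancels \<open>fact ?R\<close> and adds
      the factorial of \<open>?m\<close> to the denominator.\<close>
    have "of_nat (wt w choose ?m) = (fact (wt w) / (fact ?m * fact ?R) :: complex)"
      using binomial_fact[OF m] R by simp
    then show ?thesis
      using True card_weight_drop[OF w m, unfolded R] by simp
  next
    case False
    \<comment> \<open>Here \<open>?R + ?m\<close> is strictly below the weight of w, so every w + b
      has weight above \<open>?R\<close>.\<close>
    have "{b \<in> carrier_vec n. wt b = ?m \<and> wt (w + b) = ?R} = {}"
    proof (safe, goal_cases)
      case (1 b)
      then show ?case
        using False le wt_add_ge[OF w \<open>b \<in> carrier_vec n\<close>] by simp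
    qed
    then show ?thesis
      using False by simp
  qed
  finally show ?case by simp
qed

text \<open>The coefficient of each summand is the size of the sphere of weight s, on which the
  sphere sums do not depend on a. Letting F act on a whole row covers products of any entries of
  that row.\<close>

lemma sum_canonical_matrix_by_weight:
  fixes \<theta> :: "'a::{field,finite} \<Rightarrow> complex" and F :: "(nat \<Rightarrow> complex) \<Rightarrow> complex"
  shows "(\<Sum>s=0..n. (of_nat CARD('a) - 1) ^ s * of_nat (n choose s) * F (canonical_matrix \<theta> n s))
    = (\<Sum>a\<in>carrier_vec n. F (weight_sphere_sum \<theta> n a))"
proof -
  \<comment> \<open>The subtraction on the left is truncated; it is harmless because the field is
    non-empty.\<close>
  have q: "of_nat (CARD('a) - 1) = (of_nat CARD('a) - 1 :: complex)"
    using finite_UNIV_card_ge_0[where 'a = 'a] by (simp add: of_nat_diff)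
  have eq: "canonical_matrix \<theta> n (wt a) = weight_sphere_sum \<theta> n a" if "a \<in> carrier_vec n" for a
    using canonical_matrix_eq[OF that refl] by (auto simp: weight_sphere_sum_def)
  have "(\<Sum>a\<in>carrier_vec n. F (weight_sphere_sum \<theta> n a))
      = (\<Sum>s=0..n. \<Sum>a\<in>{a \<in> carrier_vec n. wt a = s}. F (weight_sphere_sum \<theta> n a))"
    by (rule sum.group[symmetric]) (auto simp: wt_le)
  also have "\<dots> = (\<Sum>s=0..n. \<Sum>a\<in>{a \<in> carrier_vec n. wt (a :: 'a vec) = s}. F (canonical_matrix \<theta> n s))"
    by (intro sum.cong) (auto simp: eq)
  also have "\<dots> = (\<Sum>s=0..n. (of_nat CARD('a) - 1) ^ s * of_nat (n choose s) * F (canonical_matrix \<theta> n s))"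
    by (simp add: card_weight_sphere q mult_ac)
  finally show ?thesis by simp
qed

theorem proposition5p1p4:
  fixes \<theta> :: "'a::{field,finite} \<Rightarrow> complex"
    and q n k r :: nat and \<rho> :: "nat \<Rightarrow> nat"
  assumes "q = CARD('a)"
    and "nontrivial_additive_character \<theta>"
    and "k \<ge> 1"
    and "\<And>i. i \<in> {1..k} \<Longrightarrow> \<rho> i \<le> n"
    and "r \<le> n"
    and "(\<Sum>i=1..k. \<rho> i) \<le> r"
  shows "(\<Sum>s=0..n. (of_nat q - 1) ^ s * of_nat (n choose s)
            * (\<Prod>i=1..k. canonical_matrix \<theta> n s (\<rho> i)) * canonical_matrix \<theta> n s r)
       = (if (\<Sum>i=1..k. \<rho> i) = r then 1 else 0)
            * (fact n / (fact (n - r) * (\<Prod>i=1..k. fact (\<rho> i))))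
            * (of_nat q - 1) ^ r * of_nat q ^ n"
proof -
  let ?W = "{w \<in> carrier_vec n. wt w = r} :: 'a vec set"
  let ?P = "\<lambda>a. \<Prod>i=1..k. weight_sphere_sum \<theta> n a (\<rho> i)"
  let ?C = "if (\<Sum>i=1..k. \<rho> i) = r
    then fact r / (\<Prod>i=1..k. fact (\<rho> i)) * of_nat q ^ n else (0 :: complex)"
  have "(\<Sum>s=0..n. (of_nat q - 1) ^ s * of_nat (n choose s)
            * (\<Prod>i=1..k. canonical_matrix \<theta> n s (\<rho> i)) * canonical_matrix \<theta> n s r)
      = (\<Sum>a\<in>carrier_vec n. ?P a * weight_sphere_sum \<theta> n a r)"
    using sum_canonical_matrix_by_weight[where F = "\<lambda>f. (\<Prod>i=1..k. f (\<rho> i)) * f r" and \<theta> = \<theta> and n = n]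
    by (simp add: assms(1) mult.assoc)
  also have "\<dots> = (\<Sum>w\<in>?W. \<Sum>a\<in>carrier_vec n. ?P a * cnj (\<theta> (a \<bullet> w)))"
    unfolding weight_sphere_sum_def[of \<theta> n _ r] sum_distrib_left by (rule sum.swap)
  \<comment> \<open>The transform depends on w only through its weight, which is r throughout
    \<open>?W\<close>.\<close>
  also have "\<dots> = (\<Sum>w\<in>?W. ?C)"
    using assms fourier_prod_weight_sphere_sum[OF assms(2), where k = k and \<rho> = \<rho>] by (intro sum.cong) auto
  also have "\<dots> = of_nat ((n choose r) * (q - 1) ^ r) * ?C"
    by (simp add: card_weight_sphere assms(1))
  also have "\<dots> = of_nat (n choose r) * (of_nat q - 1) ^ r * ?C"
    using finite_UNIV_card_ge_0[where 'a = 'a] by (simp add: assms(1) of_nat_diff)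
  \<comment> \<open>The factor \<open>fact r\<close> in \<open>?C\<close> cancels against the
    binomial coefficient and leaves \<open>fact n / fact (n - r)\<close>.\<close>
  also have "\<dots> = (if (\<Sum>i=1..k. \<rho> i) = r then 1 else 0)
            * (fact n / (fact (n - r) * (\<Prod>i=1..k. fact (\<rho> i))))
            * (of_nat q - 1) ^ r * of_nat q ^ n"
    by (simp add: binomial_fact[OF \<open>r \<le> n\<close>] mult_ac)
  finally show ?thesis .
qed

end
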